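(* Let $N\ge1$ be an integer, $1<p<2$, $q>1$, $\alpha>0$, $\delta=\frac{p}{2-p}$. Assume $\delta<\alpha$, or $N\le\alpha=\delta$. Then any solution $w$ of $$(|w'|^{p-2}w')'+\frac{N-1}{r}|w'|^{p-2}w'+rw'+\alpha w+|w|^{q-1}w=0\qquad (E)$$ satisfies $$w(r)=O(r^{-\delta}),\qquad w'(r)=O(r^{-\delta-1})\qquad\text{near }\infty.$$
   Context: A solution of (E) is a function $w\in C^1((R_w,\infty))$, for some $R_w\ge0$, with $|w'|^{p-2}w'\in C^1((R_w,\infty))$, satisfying (E) on $(R_w,\infty)$. *)

theory Defs
  imports "HOL-Analysis.Analysis" "HOL-Library.Landau_Symbols"
begin

text \<open>The signed power \<open>|s|^(a-1) s\<close>. Since \<open>0 powr b = 0\<close> for every exponent \<open>b\<close>, its value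
  at \<open>s = 0\<close> is \<open>0\<close>, also when \<open>a < 1\<close>; this is the continuous extension for \<open>a > 0\<close>.\<close>

definition signed_powr :: "real \<Rightarrow> real \<Rightarrow> real" where
  "signed_powr a s = \<bar>s\<bar> powr (a - 1) * s"

text \<open>The flux \<open>|w'|^(p-2) w'\<close>.\<close>

definition flux :: "real \<Rightarrow> (real \<Rightarrow> real) \<Rightarrow> real \<Rightarrow> real" where
  "flux p w r = signed_powr (p - 1) (deriv w r)"

text \<open>Only the values of \<open>w\<close> on some half-line \<open>(R, \<infinity>)\<close> matter; outside it \<open>w\<close> is arbitrary.\<close>

definition is_solution :: "nat \<Rightarrow> real \<Rightarrow> real \<Rightarrow> real \<Rightarrow> (real \<Rightarrow> real) \<Rightarrow> bool" where
  "is_solution N p q \<alpha> w \<longleftrightarrow>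
    (\<exists>R\<ge>0. w C1_differentiable_on {R<..} \<and>
      flux p w C1_differentiable_on {R<..} \<and>
      (\<forall>r>R. deriv (flux p w) r + (real N - 1) / r * flux p w r
               + r * deriv w r + \<alpha> * w r + signed_powr q (w r) = 0))"

end

theory Submission
  imports Defs
begin

text \<open>
  Let \<open>v\<close> be the flux and put \<open>y = r^\<delta> w\<close>, \<open>Y = - r^(\<delta>-1) v\<close>, \<open>m = 1/(p-1)\<close>. Then
  \<open>r y' = \<delta> y - |Y|^(m-1) Y\<close> and \<open>r Y' = (\<delta> - N) Y - |Y|^(m-1) Y + (\<alpha> + k) y\<close>, where
  \<open>k = |w|^(q-1)\<close> is bounded because the energy
  \<open>|v|^(m+1)/(m+1) + \<alpha> w^2/2 + |w|^(q+1)/(q+1)\<close> is nonincreasing. It suffices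
  to bound \<open>y\<close> and \<open>Y\<close>. In \<open>u = y - Y\<close> the superlinear terms cancel:
  \<open>r u' = - (\<alpha> - \<delta> + k) u - (\<alpha> - N + k) Y\<close>. Hence the hexagon
  \<open>|u| < M\<close>, \<open>|u - Y| < M\<close>, \<open>|Y| < K\<close> with \<open>M\<close> proportional to \<open>K\<close> and \<open>K\<close> large cannot be
  left: on \<open>Y = K\<close> the damping \<open>K^m\<close> wins since \<open>m > 1\<close>; on \<open>u = M\<close> one has \<open>Y \<ge> 0\<close> and
  \<open>u' \<le> 0\<close> by the assumption on \<open>\<alpha>\<close>, \<open>\<delta>\<close>, \<open>N\<close>; on \<open>u - Y = M\<close> one has \<open>Y \<le> 0\<close>, and the term
  \<open>\<alpha> y\<close> in \<open>r Y'\<close> dominates. Letting \<open>M\<close> grow slowly to a finite limit makes these inequalities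
  strict.
\<close>

section \<open>Barrier principle for finitely many functions\<close>

text \<open>At the first time \<open>c\<close> where some member of \<open>F\<close> is nonnegative,
  all members are at most 0 and one vanishes. Its negative derivative would make it positive just
  before \<open>c\<close>. Since \<open>step\<close> assumes all members are at most 0, each face of
  a region may use the inequalities of the others.\<close>

lemma finite_barrier_negative:
  fixes F :: "(real \<Rightarrow> real) set"
  assumes "finite F"
    and init: "\<And>f. f \<in> F \<Longrightarrow> f a < 0"
    and cont: "\<And>f. f \<in> F \<Longrightarrow> continuous_on {a..} f"
    and step: "\<And>f x. f \<in> F \<Longrightarrow> x > a \<Longrightarrow> (\<And>g. g \<in> F \<Longrightarrow> g x \<le> 0) \<Longrightarrow> f x = 0 \<Longrightarrow>
                 \<exists>D<0. (f has_real_derivative D) (at x)"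
    and "f \<in> F" "x \<ge> a"
  shows "f x < 0"
proof (rule ccontr)
  assume "\<not> f x < 0"
  define S where "S = (\<Union>g\<in>F. {t \<in> {a..x}. g t \<in> {0..}})"
  have "closed {t \<in> {a..x}. g t \<in> {0..}}" if "g \<in> F" for g
  proof -
    have "continuous_on {a..x} g"
      using cont[OF that] by (rule continuous_on_subset) auto
    then have "closed ({a..x} \<inter> g -` {0..})"
      by (intro continuous_closed_preimage) auto
    moreover have "{t \<in> {a..x}. g t \<in> {0..}} = {a..x} \<inter> g -` {0..}" by auto
    ultimately show ?thesis by metis
  qed
  then have "closed S"
    unfolding S_def using \<open>finite F\<close> by (intro closed_UN) auto
  moreover have "bounded S"
    by (rule bounded_subset[of "{a..x}"]) (auto simp: S_def)
  ultimately have "compact S" by (simp add: compact_eq_bounded_closed)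
  moreover have "S \<noteq> {}"
    using assms \<open>\<not> f x < 0\<close> by (force simp: S_def)
  ultimately obtain c where c: "c \<in> S" and cmin: "\<And>t. t \<in> S \<Longrightarrow> c \<le> t"
    using compact_attains_inf by metis
  then obtain h where h: "h \<in> F" "h c \<ge> 0" "a \<le> c" "c \<le> x"
    by (auto simp: S_def)
  have "c > a"
    using h init[OF h(1)] by (cases "c = a") auto
  have neg: "g t < 0" if "g \<in> F" "a \<le> t" "t < c" for g t
  proof (rule ccontr)
    assume "\<not> g t < 0"
    then have "t \<in> S" using that h unfolding S_def by (intro UN_I[of g]) auto
    then show False using cmin \<open>t < c\<close> by force
  qed
  have le: "g c \<le> 0" if g: "g \<in> F" for g
  \<comment> \<open>A positive value at \<open>c\<close> would force a zero strictly before
    \<open>c\<close> by the intermediate value theorem, against \<open>neg\<close>.\<close>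
  proof (rule ccontr)
    assume "\<not> g c \<le> 0"
    moreover have "continuous_on {a..c} g"
      using cont[OF g] by (rule continuous_on_subset) auto
    ultimately obtain t where "a \<le> t" "t \<le> c" "g t = 0"
      using IVT'[of g a 0 c] init[OF g] \<open>a < c\<close> by auto
    then show False using neg[OF g, of t] \<open>\<not> g c \<le> 0\<close> by (cases "t = c") auto
  qed
  then have "h c = 0" using h by (simp add: antisym)
  then obtain D where "D < 0" "(h has_real_derivative D) (at c)"
    using step[OF h(1) \<open>c > a\<close>] le by blast
  then obtain e where e: "e > 0" "\<And>d. d > 0 \<Longrightarrow> d < e \<Longrightarrow> h c < h (c - d)"
    using DERIV_neg_dec_left by blast
  define d where "d = min (e/2) (c - a)"
  have "d > 0" "d < e" "a \<le> c - d" using e \<open>c > a\<close> by (auto simp: d_def)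
  then show False using e(2)[of d] neg[OF h(1), of "c - d"] \<open>h c = 0\<close> by auto
qed

section \<open>Calculus of signed powers\<close>

text \<open>Away from 0 this is the chain rule; at 0 the difference quotient is bounded by
  |h|^(a-1), which tends to 0. Including 0 lets the energy be differentiated at zeros of w and of
  the flux.\<close>

lemma has_real_derivative_abs_powr:
  fixes a x :: real
  assumes "a > 1"
  shows "((\<lambda>x. \<bar>x\<bar> powr a) has_real_derivative a * signed_powr (a - 1) x) (at x)"
proof (cases "x = 0")
  case True
  have "((\<lambda>h. \<bar>h\<bar> powr a / h) \<longlongrightarrow> 0) (at 0)"
  proof (rule Lim_null_comparison)
    show "\<forall>\<^sub>F h in at 0. norm (\<bar>h\<bar> powr a / h) \<le> \<bar>h\<bar> powr (a - 1)"
      using assms by (intro always_eventually) (auto simp: powr_diff)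
    have "((\<lambda>h::real. \<bar>h\<bar> powr (a - 1)) \<longlongrightarrow> \<bar>0\<bar> powr (a - 1)) (at 0)"
      using assms by (intro tendsto_intros tendsto_powr') auto
    then show "((\<lambda>h::real. \<bar>h\<bar> powr (a - 1)) \<longlongrightarrow> 0) (at 0)" by simp
  qed
  then show ?thesis using True by (simp add: DERIV_def signed_powr_def)
next
  case False
  have *: "((\<lambda>x. \<bar>x\<bar> powr a) has_real_derivative sgn x * (a * \<bar>x\<bar> powr (a - 1))) (at x)"
  proof -
    have "(abs has_real_derivative sgn x) (at x)"
      using has_derivative_norm[OF False] unfolding has_field_derivative_def
      by (rule has_derivative_eq_rhs[OF has_derivative_transform[of _ UNIV, rotated 2]])
        (auto simp: fun_eq_iff mult.commute)
    then show ?thesis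
      using DERIV_chain2[of "\<lambda>z. z powr a" "a * \<bar>x\<bar> powr (a - 1)" abs x "sgn x" UNIV]
        has_real_derivative_powr[of "\<bar>x\<bar>" a] False
      by (simp add: mult_ac)
  qed
  have "sgn x * (a * \<bar>x\<bar> powr (a - 1)) = a * signed_powr (a - 1) x"
    using False by (simp add: signed_powr_def powr_diff sgn_real_def field_simps power2_eq_square
        split: abs_split)
  with * show ?thesis by simp
qed

text \<open>Recovers w' from the flux, which turns the equation into a first-order system.\<close>

lemma signed_powr_inverse:
  assumes "1 < p"
  shows "signed_powr (1 / (p - 1)) (signed_powr (p - 1) s) = s"
proof (cases "s = 0")
  case False
  have "\<bar>signed_powr (p - 1) s\<bar> = \<bar>s\<bar> powr (p - 1)"
    using False by (simp add: signed_powr_def abs_mult powr_diff power2_eq_square)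
  moreover have "(p - 1) * (1 / (p - 1) - 1) + (p - 1 - 1) = 0"
    using assms by (simp add: field_simps)
  ultimately show ?thesis
    using False unfolding signed_powr_def
    by (simp add: powr_powr powr_add[symmetric] mult.assoc[symmetric])
qed (simp add: signed_powr_def)

section \<open>The invariant hexagon of the planar system\<close>

lemma planar_bounded:
  fixes y Y k :: "real \<Rightarrow> real" and N :: real
  assumes "a \<ge> 1" "m > 1" "\<alpha> > 0" "\<delta> > 0" "N \<ge> 0"
    and sub: "\<delta> < \<alpha> \<or> (N \<le> \<alpha> \<and> \<alpha> = \<delta>)"
    and k: "\<And>r. r \<ge> a \<Longrightarrow> 0 \<le> k r" "\<And>r. r \<ge> a \<Longrightarrow> k r \<le> B"
    and y: "\<And>r. r \<ge> a \<Longrightarrow> (y has_real_derivative (\<delta> * y r - signed_powr m (Y r)) / r) (at r)"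
    and Y: "\<And>r. r \<ge> a \<Longrightarrow> (Y has_real_derivative
          ((\<delta> - N) * Y r - signed_powr m (Y r) + (\<alpha> + k r) * y r) / r) (at r)"
  shows "\<exists>C. \<forall>r\<ge>a. \<bar>y r\<bar> \<le> C \<and> \<bar>Y r\<bar> \<le> C"
proof -
  \<comment> \<open>The first summand yields \<open>L1\<close>, used on the face u - Y = M; the
    second yields \<open>L2\<close>, used on the face u = M when \<alpha> < N.\<close>
  define L where "L = (3 * \<alpha> + \<delta>) / \<alpha> + (if \<delta> < \<alpha> then N / (\<alpha> - \<delta>) else 0)"
  have L1: "\<alpha> * L \<ge> 3 * \<alpha> + \<delta>"
    using assms by (auto simp: L_def field_simps)
  have L3: "L \<ge> 3"
    using assms by (auto simp: L_def field_simps intro!: add_nonneg_nonneg)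
  have L2: "(\<alpha> - \<delta>) * L \<ge> N" if "\<delta> < \<alpha>"
  proof -
    have "L \<ge> N / (\<alpha> - \<delta>)" using that assms by (auto simp: L_def)
    then show ?thesis using that by (simp add: field_simps)
  qed
  \<comment> \<open>On Y = K one has y \<le> M + K \<le> (2 L + 1) K, so all terms of r Y' except
    the damping add up to at most Q K.\<close>
  define Q where "Q = \<bar>\<delta> - N\<bar> + (\<alpha> + B) * (2 * L + 1)"
  \<comment> \<open>The initial values place the starting point strictly inside the hexagon; the
    last summand forces K^(m-1) > Q.\<close>
  define K where "K = 2 + \<bar>y a\<bar> + 2 * \<bar>Y a\<bar> + (\<bar>Q\<bar> + 1) powr (1 / (m - 1))"
  have K: "K > 1 + \<bar>y a\<bar> + 2 * \<bar>Y a\<bar>"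
    unfolding K_def using powr_ge_zero[of "\<bar>Q\<bar> + 1" "1 / (m - 1)"] by linarith
  have "\<bar>Q\<bar> + 1 = ((\<bar>Q\<bar> + 1) powr (1 / (m - 1))) powr (m - 1)"
    using assms by (simp add: powr_powr)
  also have "\<dots> \<le> K powr (m - 1)"
    using assms by (intro powr_mono2) (auto simp: K_def)
  finally have KQ: "K powr (m - 1) > Q" by linarith
  have "K > 0" using K by linarith
  \<comment> \<open>Stays between L K and 2 L K because r \<ge> 1; its derivative L K / r^2 supplies
    the strict sign on the faces involving \<open>M\<close>.\<close>
  define M where "M = (\<lambda>r::real. L * K * (2 - 1 / r))"
  have Mle: "L * K \<le> M r" "M r \<le> 2 * L * K" if "r \<ge> a" for r
  proof -
    have "1 \<le> 2 - 1 / r" "2 - 1 / r \<le> 2" using that assms by (auto simp: field_simps)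
    moreover have "L * K > 0" using L3 \<open>K > 0\<close> by simp
    ultimately show "L * K \<le> M r" "M r \<le> 2 * L * K"
      using mult_left_mono[of 1 "2 - 1 / r" "L * K"] mult_left_mono[of "2 - 1 / r" 2 "L * K"]
      by (simp_all add: M_def)
  qed
  have LK: "L * K \<ge> 3 * K" using L3 \<open>K > 0\<close> by simp
  have M': "(M has_real_derivative (L * K / r) / r) (at r)" if "r \<ge> a" for r
    unfolding M_def using that assms
    by (auto intro!: derivative_eq_intros simp: field_simps power2_eq_square)
  \<comment> \<open>All six functions are negative exactly inside the hexagon;
    \<open>y r - 2 * Y r\<close> is u - Y.\<close>
  define F where "F = (\<Union>s\<in>{1, -1}. {\<lambda>r. s * (y r - Y r) - M r,
      \<lambda>r. s * (y r - 2 * Y r) - M r, \<lambda>r. s * Y r - K})"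
  have main: "f r < 0" if "f \<in> F" "r \<ge> a" for f r
  proof (rule finite_barrier_negative[OF _ _ _ _ that])
    show "finite F" by (simp add: F_def)
    show "f a < 0" if "f \<in> F" for f
      using that K LK Mle(1)[of a] by (auto simp: F_def)
    have c: "continuous_on {a..} y" "continuous_on {a..} Y" "continuous_on {a..} M"
      using y Y M' by (auto intro!: continuous_at_imp_continuous_on dest: DERIV_isCont)
    show "continuous_on {a..} f" if "f \<in> F" for f
      using that unfolding F_def by (auto intro!: continuous_intros c)
  next
    fix f r assume f: "f \<in> F" and "r > a" and le: "\<And>g. g \<in> F \<Longrightarrow> g r \<le> 0" and f0: "f r = 0"
    have "r > 0" "r \<ge> a" using \<open>r > a\<close> assms by auto
    obtain s :: real where s: "s = 1 \<or> s = -1"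
      and f: "f = (\<lambda>r. s * (y r - Y r) - M r) \<or> f = (\<lambda>r. s * (y r - 2 * Y r) - M r) \<or>
        f = (\<lambda>r. s * Y r - K)"
      using f unfolding F_def by blast
    \<comment> \<open>The system is odd in (y, Y), so the sign \<open>s\<close> reduces opposite
      faces to a single case.\<close>
    define U Z P where "U = s * y r" and "Z = s * Y r" and "P = \<bar>Z\<bar> powr (m - 1)"
    have sp: "signed_powr m (Y r) = P * s * Z"
      using s by (auto simp: signed_powr_def P_def Z_def)
    have in_F: "(\<lambda>r. s * (y r - Y r) - M r) \<in> F" "(\<lambda>r. s * (y r - 2 * Y r) - M r) \<in> F"
         "(\<lambda>r. s * Y r - K) \<in> F" "(\<lambda>r. (-s) * Y r - K) \<in> F"
      using s by (auto simp: F_def)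
    have b: "U - Z \<le> M r" "U - 2 * Z \<le> M r" "Z \<le> K" "- Z \<le> K"
      using le[OF in_F(1)] le[OF in_F(2)] le[OF in_F(3)] le[OF in_F(4)]
      by (auto simp: U_def Z_def algebra_simps)
    note kr = k[OF \<open>r \<ge> a\<close>]
    note Mr = Mle[OF \<open>r \<ge> a\<close>]
    note d = y[OF \<open>r \<ge> a\<close>] Y[OF \<open>r \<ge> a\<close>] M'[OF \<open>r \<ge> a\<close>]
    have "L * K / r > 0" using LK \<open>K > 0\<close> \<open>r > 0\<close> by (intro divide_pos_pos) auto
    have "P \<ge> 0" by (simp add: P_def)
    from f consider "f = (\<lambda>r. s * (y r - Y r) - M r)" | "f = (\<lambda>r. s * (y r - 2 * Y r) - M r)"
      | "f = (\<lambda>r. s * Y r - K)" by blast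
    then show "\<exists>D<0. (f has_real_derivative D) (at r)"
    proof cases
      case 1
      \<comment> \<open>The terms P Z have cancelled. The numerator equals -((\<alpha> - \<delta>)
        (U - Z) + (\<alpha> - N) Z + k U) - L K / r.\<close>
      let ?D = "(\<delta> * U - (\<delta> - N) * Z - (\<alpha> + k r) * U - L * K / r) / r"
      have "(f has_real_derivative ?D) (at r)"
        unfolding 1 by (rule derivative_eq_intros d refl)+
          (use s \<open>r > 0\<close> in \<open>auto simp: sp U_def Z_def field_simps\<close>)
      moreover have "?D < 0"
      proof -
        have UZ: "U - Z = M r" using f0 1 by (simp add: U_def Z_def algebra_simps)
        then have "Z \<ge> 0" using b by simp
        \<comment> \<open>Only \<alpha> < N is delicate: there N Z \<le> N K \<le> (\<alpha> -
          \<delta>) L K \<le> (\<alpha> - \<delta>) M.\<close>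
        have "(\<alpha> - \<delta>) * (U - Z) + (\<alpha> - N) * Z \<ge> 0"
        proof (cases "N \<le> \<alpha>")
          case True
          then show ?thesis using sub \<open>Z \<ge> 0\<close> UZ Mr LK \<open>K > 0\<close> by auto
        next
          case False
          then have "\<delta> < \<alpha>" using sub by auto
          have "N * Z \<le> N * K" using b \<open>N \<ge> 0\<close> by (intro mult_left_mono)
          also have "\<dots> \<le> (\<alpha> - \<delta>) * L * K"
            using L2[OF \<open>\<delta> < \<alpha>\<close>] \<open>K > 0\<close> by simp
          also have "\<dots> \<le> (\<alpha> - \<delta>) * (U - Z)"
            unfolding UZ mult.assoc using Mr \<open>\<delta> < \<alpha>\<close> by (intro mult_left_mono) auto
          finally have "N * Z \<le> (\<alpha> - \<delta>) * (U - Z)" .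
          moreover have "\<alpha> * Z \<ge> 0" using \<open>Z \<ge> 0\<close> \<open>\<alpha> > 0\<close> by simp
          moreover have "(\<alpha> - N) * Z = \<alpha> * Z - N * Z" by (simp add: left_diff_distrib)
          ultimately show ?thesis by linarith
        qed
        moreover have "k r * U \<ge> 0" using kr UZ \<open>Z \<ge> 0\<close> Mr LK \<open>K > 0\<close> by simp
        ultimately show ?thesis
          using \<open>L * K / r > 0\<close> \<open>r > 0\<close> by (intro divide_neg_pos) (simp_all add: algebra_simps)
      qed
      ultimately show ?thesis by blast
    next
      case 2
      let ?D = "(\<delta> * U + P * Z - 2 * ((\<delta> - N) * Z + (\<alpha> + k r) * U) - L * K / r) / r"
      have "(f has_real_derivative ?D) (at r)"
        unfolding 2 by (rule derivative_eq_intros d refl)+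
          (use s \<open>r > 0\<close> in \<open>auto simp: sp U_def Z_def field_simps\<close>)
      moreover have "?D < 0"
      proof -
        have UZ: "U - 2 * Z = M r" using f0 2 by (simp add: U_def Z_def algebra_simps)
        then have "Z \<le> 0" using b by simp
        have UZ0: "U - Z \<ge> 0" using UZ b Mr LK \<open>K > 0\<close> by linarith
        have U0: "U \<ge> 0" using UZ b Mr LK \<open>K > 0\<close> by linarith
        \<comment> \<open>The numerator is -(\<alpha> - \<delta>) (U - Z) - \<alpha> U - (\<alpha> +
          \<delta>) Z + P Z + 2 N Z - 2 k U - L K / r. Only -(\<alpha> + \<delta>) Z can be
          positive, and it is at most (\<alpha> + \<delta>) K \<le> \<alpha> U.\<close>
        have "U \<ge> (L - 2) * K" using UZ b Mr by (simp add: algebra_simps)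
        then have "\<alpha> * U \<ge> \<alpha> * ((L - 2) * K)" using \<open>\<alpha> > 0\<close> by (intro mult_left_mono) auto
        moreover have "\<alpha> * ((L - 2) * K) \<ge> (\<alpha> + \<delta>) * K"
          using mult_right_mono[OF L1, of K] \<open>K > 0\<close> by (simp add: algebra_simps)
        moreover have "(\<alpha> + \<delta>) * - Z \<le> (\<alpha> + \<delta>) * K" using b assms by (intro mult_left_mono) auto
        moreover have "(\<alpha> - \<delta>) * (U - Z) \<ge> 0"
          using sub UZ0 by (intro mult_nonneg_nonneg) auto
        moreover have "P * Z \<le> 0" using \<open>P \<ge> 0\<close> \<open>Z \<le> 0\<close> by (rule mult_nonneg_nonpos)
        moreover have "k r * U \<ge> 0" using kr U0 by simp
        moreover have "N * Z \<le> 0" using \<open>Z \<le> 0\<close> \<open>N \<ge> 0\<close> by (simp add: mult_nonneg_nonpos)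
        ultimately show ?thesis
          using \<open>L * K / r > 0\<close> \<open>r > 0\<close> by (intro divide_neg_pos) (simp_all add: algebra_simps)
      qed
      ultimately show ?thesis by blast
    next
      case 3
      let ?D = "((\<delta> - N) * Z - P * Z + (\<alpha> + k r) * U) / r"
      have "(f has_real_derivative ?D) (at r)"
        unfolding 3 by (rule derivative_eq_intros d refl)+
          (use s \<open>r > 0\<close> in \<open>auto simp: sp U_def Z_def field_simps\<close>)
      moreover have "?D < 0"
      proof -
        have ZK: "Z = K" using f0 3 by (simp add: U_def Z_def algebra_simps)
        have PQ: "P > Q" using KQ \<open>K > 0\<close> by (simp add: P_def ZK)
        have "U \<le> (2 * L + 1) * K" using b Mr ZK by (simp add: algebra_simps)
        then have "(\<alpha> + k r) * U \<le> (\<alpha> + k r) * ((2 * L + 1) * K)"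
          using kr \<open>\<alpha> > 0\<close> by (intro mult_left_mono) auto
        also have "\<dots> \<le> (\<alpha> + B) * ((2 * L + 1) * K)"
          using kr L3 \<open>K > 0\<close> by (intro mult_right_mono) auto
        finally have "(\<alpha> + k r) * U \<le> (\<alpha> + B) * ((2 * L + 1) * K)" .
        moreover have "(\<delta> - N) * K \<le> \<bar>\<delta> - N\<bar> * K" using \<open>K > 0\<close> by (intro mult_right_mono) auto
        moreover have "Q * K < P * K" using PQ \<open>K > 0\<close> by simp
        ultimately show ?thesis
          unfolding ZK using \<open>r > 0\<close> by (intro divide_neg_pos) (simp_all add: Q_def algebra_simps)
      qed
      ultimately show ?thesis by blast
    qed
  qed
  have "\<bar>y r\<bar> \<le> 2 * L * K + K \<and> \<bar>Y r\<bar> \<le> 2 * L * K + K" if "r \<ge> a" for r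
  proof -
    have *: "s * (y r - Y r) \<le> M r" "s * Y r \<le> K" if "s = 1 \<or> s = -1" for s
      using main[OF _ \<open>r \<ge> a\<close>, of "\<lambda>r. s * (y r - Y r) - M r"]
            main[OF _ \<open>r \<ge> a\<close>, of "\<lambda>r. s * Y r - K"] that by (auto simp: F_def)
    show ?thesis
      using *[of 1] *[of "-1"] Mle[OF that] LK \<open>K > 0\<close> by auto
  qed
  then show ?thesis by blast
qed

section \<open>Scaling, energy and regularity\<close>

lemma signed_powr_scale:
  assumes "c > 0"
  shows "signed_powr m (c * s) = c powr m * signed_powr m s"
proof -
  have "c powr m = c powr (m - 1) * c"
    using assms by (simp add: powr_diff)
  then show ?thesis
    using assms by (simp add: signed_powr_def abs_mult powr_mult)
qed

text \<open>In E' the contributions of \<alpha> w and |w|^(q-1) w cancel, leaving -(n/r) v w' - r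
  w'^2, and v w' \<ge> 0 because w' is a signed power of v.\<close>

lemma energy_bounded:
  fixes w v :: "real \<Rightarrow> real"
  assumes "a > 0" "n \<ge> 0" "m > 0" "q > 0" "\<alpha> > 0"
    and w: "\<And>r. r \<ge> a \<Longrightarrow> (w has_real_derivative signed_powr m (v r)) (at r)"
    and v: "\<And>r. r \<ge> a \<Longrightarrow> (v has_real_derivative
       - (n / r * v r + r * signed_powr m (v r) + \<alpha> * w r + signed_powr q (w r))) (at r)"
  shows "\<exists>B. \<forall>r\<ge>a. \<bar>w r\<bar> \<le> B"
proof -
  define E where "E = (\<lambda>r. \<bar>v r\<bar> powr (m + 1) / (m + 1) + \<alpha> * (w r)\<^sup>2 / 2
    + \<bar>w r\<bar> powr (q + 1) / (q + 1))"
  have E': "\<exists>D. (E has_real_derivative D) (at r) \<and> D \<le> 0" if "r \<ge> a" for r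
  proof (intro exI conjI)
    let ?s = "signed_powr m (v r)" and ?g = "signed_powr q (w r)"
    have 1: "((\<lambda>r. \<bar>v r\<bar> powr (m + 1) / (m + 1)) has_real_derivative
        ?s * - (n / r * v r + r * ?s + \<alpha> * w r + ?g)) (at r)"
      by (rule DERIV_cong[OF DERIV_cdivide[OF
            DERIV_chain2[OF has_real_derivative_abs_powr[of "m + 1"] v[OF that]], of "m + 1"]])
        (use assms in simp_all)
    have 2: "((\<lambda>r. \<bar>w r\<bar> powr (q + 1) / (q + 1)) has_real_derivative ?g * ?s) (at r)"
      by (rule DERIV_cong[OF DERIV_cdivide[OF
            DERIV_chain2[OF has_real_derivative_abs_powr[of "q + 1"] w[OF that]], of "q + 1"]])
        (use assms in simp_all)
    have 3: "((\<lambda>r. \<alpha> * (w r)\<^sup>2 / 2) has_real_derivative \<alpha> * w r * ?s) (at r)"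
      by (auto intro!: derivative_eq_intros w[OF that])
    show "(E has_real_derivative - (n / r * (?s * v r) + r * ?s\<^sup>2)) (at r)"
      unfolding E_def
      by (rule DERIV_cong[OF DERIV_add[OF DERIV_add[OF 1 3] 2]])
        (simp add: power2_eq_square algebra_simps)
    have "?s * v r \<ge> 0" by (simp add: signed_powr_def mult.assoc)
    moreover have "n / r \<ge> 0" "r \<ge> 0" using assms(1,2) that by simp_all
    ultimately have "n / r * (?s * v r) \<ge> 0" "r * ?s\<^sup>2 \<ge> 0"
      by (blast intro: mult_nonneg_nonneg zero_le_power2)+
    then show "- (n / r * (?s * v r) + r * ?s\<^sup>2) \<le> 0" by linarith
  qed
  have "\<bar>w r\<bar> \<le> sqrt (2 * E a / \<alpha>)" if "r \<ge> a" for r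
  proof -
    have "E r \<le> E a"
      by (rule DERIV_nonpos_imp_nonincreasing[OF that]) (use E' in auto)
    moreover have "\<alpha> * (w r)\<^sup>2 / 2 \<le> E r"
      using assms by (simp add: E_def)
    ultimately have "(w r)\<^sup>2 \<le> 2 * E a / \<alpha>"
      using assms by (simp add: field_simps)
    then show ?thesis using real_sqrt_le_mono by fastforce
  qed
  then show ?thesis by blast
qed

lemma C1_differentiable_on_imp_DERIV:
  fixes f :: "real \<Rightarrow> real"
  assumes "f C1_differentiable_on S" "x \<in> S"
  shows "(f has_real_derivative deriv f x) (at x)"
  using assms unfolding C1_differentiable_on_def
  by (metis has_real_derivative_iff_has_vector_derivative DERIV_imp_deriv)

section \<open>Rescaling of the solution and decay rates\<close>

theorem proposition4p1:
  fixes N :: nat and p q \<alpha> \<delta> :: real and w :: "real \<Rightarrow> real"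
  assumes "N \<ge> 1" and "1 < p" and "p < 2" and "q > 1" and "\<alpha> > 0"
    and "\<delta> = p / (2 - p)"
    and "\<delta> < \<alpha> \<or> (real N \<le> \<alpha> \<and> \<alpha> = \<delta>)"
    and "is_solution N p q \<alpha> w"
  shows "w \<in> O[at_top](\<lambda>r. r powr (- \<delta>)) \<and>
         deriv w \<in> O[at_top](\<lambda>r. r powr (- \<delta> - 1))"
proof -
  obtain R where "R \<ge> 0" and C1: "w C1_differentiable_on {R<..}" "flux p w C1_differentiable_on {R<..}"
    and eq: "\<And>r. r > R \<Longrightarrow> deriv (flux p w) r + (real N - 1) / r * flux p w r
               + r * deriv w r + \<alpha> * w r + signed_powr q (w r) = 0"
    using assms(8) unfolding is_solution_def by blast
  \<comment> \<open>Moves into the open half-line and secures a \<ge> 1, as the planar estimate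
    requires.\<close>
  define a where "a = R + 1"
  have a: "a \<ge> 1" "\<And>r. r \<ge> a \<Longrightarrow> r > R" "\<And>r. r \<ge> a \<Longrightarrow> r > 0" using \<open>R \<ge> 0\<close> by (auto simp: a_def)
  define m where "m = 1 / (p - 1)"
  have m: "m > 1" using assms by (simp add: m_def)
  \<comment> \<open>The aim is (\<delta> - 1) m = \<delta> + 1, the identity that singles out
    \<delta>: with it both rescaled equations carry the same term |Y|^(m-1) Y, free of powers of
    r.\<close>
  have "\<delta> - 1 = 2 * (p - 1) / (2 - p)" "\<delta> + 1 = 2 / (2 - p)"
    using assms(3) unfolding assms(6) by (simp_all add: field_simps)
  moreover have "2 * t / b * (1 / t) = 2 / b" if "t \<noteq> 0" for t b :: real
    using that by simp
  ultimately have \<delta>: "\<delta> > 0" "(\<delta> - 1) * m = \<delta> + 1"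
    using assms(2,3) by (simp_all only: m_def) (simp_all add: assms(6))
  define v where "v = flux p w"
  have dw: "deriv w r = signed_powr m (v r)" for r
    using signed_powr_inverse[OF assms(2)] by (simp add: v_def flux_def m_def)
  have w': "(w has_real_derivative signed_powr m (v r)) (at r)" if "r \<ge> a" for r
    using C1_differentiable_on_imp_DERIV[OF C1(1), of r] a(2)[OF that] by (simp add: dw)
  have v': "(v has_real_derivative - ((real N - 1) / r * v r + r * signed_powr m (v r) + \<alpha> * w r
       + signed_powr q (w r))) (at r)" if "r \<ge> a" for r
  proof -
    have "deriv v r = - ((real N - 1) / r * v r + r * signed_powr m (v r) + \<alpha> * w r
       + signed_powr q (w r))"
      using eq[OF a(2)[OF that]] by (simp add: dw v_def)
    then show ?thesis
      using C1_differentiable_on_imp_DERIV[OF C1(2), of r] a(2)[OF that] by (simp add: v_def)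
  qed
  obtain B where B: "\<And>r. r \<ge> a \<Longrightarrow> \<bar>w r\<bar> \<le> B"
    using energy_bounded[of a "real N - 1" m q \<alpha> w v] w' v' a m assms by auto
  define k where "k = (\<lambda>r. \<bar>w r\<bar> powr (q - 1))"
  define y where "y = (\<lambda>r. r powr \<delta> * w r)"
  define Y where "Y = (\<lambda>r. - (r powr (\<delta> - 1) * v r))"
  have spY: "signed_powr m (Y r) = - (r powr (\<delta> + 1) * signed_powr m (v r))" if "r > 0" for r
  proof -
    have "signed_powr m (Y r) = signed_powr m (r powr (\<delta> - 1) * - v r)" by (simp add: Y_def)
    also have "\<dots> = (r powr (\<delta> - 1)) powr m * signed_powr m (- v r)"
      using that by (intro signed_powr_scale) auto
    also have "\<dots> = - (r powr (\<delta> + 1) * signed_powr m (v r))"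
      by (simp add: powr_powr \<delta> signed_powr_def)
    finally show ?thesis .
  qed
  have "\<exists>C. \<forall>r\<ge>a. \<bar>y r\<bar> \<le> C \<and> \<bar>Y r\<bar> \<le> C"
  proof (rule planar_bounded[where N = "real N" and k = k and \<alpha> = \<alpha> and B = "B powr (q - 1)"])
    show "0 \<le> k r" for r by (simp add: k_def)
    show "k r \<le> B powr (q - 1)" if "r \<ge> a" for r
      using B[OF that] assms by (auto simp: k_def intro!: powr_mono2)
  next
    fix r assume "r \<ge> a"
    then have r: "r > 0" using a by simp
    \<comment> \<open>With every power expressed through \<open>r powr (\<delta> - 1)\<close>, both
      derivative identities become purely algebraic.\<close>
    have pw: "r powr \<delta> = r * r powr (\<delta> - 1)" "r powr (1 + \<delta>) = r * r * r powr (\<delta> - 1)"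
      "r powr (\<delta> - 2) = r powr (\<delta> - 1) / r"
      using r by (simp_all add: powr_diff powr_add power2_eq_square)
    note P = has_real_derivative_powr[OF r]
    show "(y has_real_derivative (\<delta> * y r - signed_powr m (Y r)) / r) (at r)"
      unfolding spY[OF r] unfolding y_def
      by (rule DERIV_cong[OF DERIV_mult[OF P w'[OF \<open>r \<ge> a\<close>]]])
        (use r in \<open>simp add: pw add.commute[of \<delta> 1] field_simps\<close>)
    \<comment> \<open>The power nonlinearity is absorbed as a linear term with the bounded
      coefficient \<open>k\<close>.\<close>
    have kw: "signed_powr q (w r) = k r * w r" by (simp add: signed_powr_def k_def)
    show "(Y has_real_derivative
          ((\<delta> - real N) * Y r - signed_powr m (Y r) + (\<alpha> + k r) * y r) / r) (at r)"
      unfolding spY[OF r] unfolding y_def Y_def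
      by (rule DERIV_cong[OF DERIV_minus[OF DERIV_mult[OF P v'[OF \<open>r \<ge> a\<close>]]]])
        (use r in \<open>simp add: kw pw add.commute[of \<delta> 1] field_simps\<close>)
  qed (use a m \<delta> assms in auto)
  then obtain C where C: "\<And>r. r \<ge> a \<Longrightarrow> \<bar>y r\<bar> \<le> C" "\<And>r. r \<ge> a \<Longrightarrow> \<bar>Y r\<bar> \<le> C" by blast
  have "w \<in> O[at_top](\<lambda>r. r powr (- \<delta>))"
  proof (rule bigoI[of _ C], rule eventually_at_top_linorderI[of a])
    fix r assume "a \<le> r"
    then show "norm (w r) \<le> C * norm (r powr - \<delta>)"
      using C(1)[of r] a(3)[of r] by (simp add: y_def abs_mult powr_minus field_simps)
  qed
  moreover have "deriv w \<in> O[at_top](\<lambda>r. r powr (- \<delta> - 1))"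
  proof (rule bigoI[of _ "C powr m"], rule eventually_at_top_linorderI[of a])
    fix r assume "a \<le> r"
    then have r: "r > 0" using a by simp
    \<comment> \<open>By \<open>spY\<close> this quantity is also r^(\<delta>+1) |w'|, so the bound
      on \<open>Y\<close> is a decay rate for w'.\<close>
    have "\<bar>signed_powr m (Y r)\<bar> = \<bar>Y r\<bar> powr m"
      by (simp add: signed_powr_def abs_mult powr_diff)
    also have "\<dots> \<le> C powr m"
      using C(2)[OF \<open>a \<le> r\<close>] m by (intro powr_mono2) auto
    finally have le: "r powr (\<delta> + 1) * \<bar>deriv w r\<bar> \<le> C powr m"
      by (simp add: spY[OF r] dw abs_mult)
    have "r powr (- \<delta> - 1) = 1 / r powr (\<delta> + 1)"
      using powr_minus_divide[of r "\<delta> + 1"] by simp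
    then show "norm (deriv w r) \<le> C powr m * norm (r powr (- \<delta> - 1))"
      using r le by (simp add: pos_le_divide_eq mult.commute)
  qed
  ultimately show ?thesis by blast
qed

end
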